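(* Let $d\ge 2$, let $P$ be a $d$-polytope, and let $G(P)$ be the graph of $P$. Then every even subgraph of $G(P)$ is the symmetric difference of (finitely many) facial cycles of $P$, where each facial cycle is regarded as an even subgraph of $G(P)$. In particular, every cycle in $G(P)$, regarded as an even subgraph, is the symmetric difference of facial cycles of $P$.
   Context: A polytope is the convex hull of a finite set of points in some $\mathbb{R}^{n}$. Its dimension is one less than the maximum number of affinely independent points in it, and a $d$-polytope is a polytope of dimension $d$. A face of a polytope $P$ is $P$ itself, or the intersection of $P$ with a hyperplane that contains $P$ in one of its closed halfspaces. Faces of dimension $0$ and $1$ are the vertices and edges of $P$, and a $2$-face is a face of dimension $2$ (so if $d=2$, the polytope $P$ itself is a $2$-face). The graph $G(P)$ is the abstract graph whose vertices are the vertices of $P$ and whose edges are the edges of $P$. An even subgraph of a graph $G$ is a spanning subgraph of $G$ (one with the same vertex set as $G$) in which every vertex has even degree. A cycle in $G$ is regarded as an even subgraph by adding all the remaining vertices of $G$ as isolated vertices. The symmetric difference of two spanning subgraphs $G'$ and $G''$ of $G$ is the spanning subgraph of $G$ whose edge set is the symmetric difference of $E(G')$ and $E(G'')$. This extends to finite collections by iteration, with the empty symmetric difference being the spanning subgraph with no edges. A cycle in $G(P)$ is facial if it bounds a $2$-face of $P$, that is, if it is the cycle formed by the vertices and edges of some $2$-face of $P$. *)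

theory Defs
  imports "HOL-Analysis.Analysis"
begin

section \<open>Simple graphs and their even subgraphs\<close>

text \<open>
  Edges are the two-element sets of their endpoints.
\<close>

record 'a ugraph =
  verts :: "'a set"
  edges :: "'a set set"

definition ugraph :: "'a ugraph \<Rightarrow> bool" where
  "ugraph G \<longleftrightarrow> (\<forall>e\<in>edges G. e \<subseteq> verts G \<and> card e = 2)"

definition subgraph :: "'a ugraph \<Rightarrow> 'a ugraph \<Rightarrow> bool" where
  "subgraph H G \<longleftrightarrow> ugraph H \<and> verts H \<subseteq> verts G \<and> edges H \<subseteq> edges G"

definition spanning_subgraph :: "'a ugraph \<Rightarrow> 'a ugraph \<Rightarrow> bool" where
  "spanning_subgraph H G \<longleftrightarrow> subgraph H G \<and> verts H = verts G"

definition degree :: "'a ugraph \<Rightarrow> 'a \<Rightarrow> nat" where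
  "degree G v = card {e \<in> edges G. v \<in> e}"

definition even_subgraph :: "'a ugraph \<Rightarrow> 'a ugraph \<Rightarrow> bool" where
  "even_subgraph H G \<longleftrightarrow> spanning_subgraph H G \<and> (\<forall>v\<in>verts H. even (degree H v))"

definition cycle_graph :: "'a ugraph \<Rightarrow> bool" where
  "cycle_graph C \<longleftrightarrow>
     (\<exists>vs. distinct vs \<and> 3 \<le> length vs \<and>
        verts C = set vs \<and>
        edges C = {{vs ! i, vs ! (Suc i mod length vs)} | i. i < length vs})"

definition cycle_in :: "'a ugraph \<Rightarrow> 'a ugraph \<Rightarrow> bool" where
  "cycle_in C G \<longleftrightarrow> cycle_graph C \<and> subgraph C G"

text \<open>
  A subgraph of \<open>G\<close> regarded as a spanning subgraph: the remaining vertices of \<open>G\<close> are added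
  as isolated vertices.
\<close>

definition as_spanning :: "'a ugraph \<Rightarrow> 'a ugraph \<Rightarrow> 'a ugraph" where
  "as_spanning G C = \<lparr>verts = verts G, edges = edges C\<rparr>"

lemma cycle_imp_even_subgraph:
  assumes "cycle_in C G"
    and G: "ugraph G"
  shows "even_subgraph (as_spanning G C) G"
proof -
  from assms(1) obtain vs where d: "distinct vs" and n: "3 \<le> length vs" and V: "verts C = set vs"
    and E: "edges C = {{vs ! i, vs ! (Suc i mod length vs)} | i. i < length vs}"
    and sub: "edges C \<subseteq> edges G"
    by (auto simp: cycle_in_def cycle_graph_def subgraph_def)
  let ?n = "length vs"
  have "even (card {e \<in> edges C. v \<in> e})" for v
  proof (cases "v \<in> set vs")
    case True
    then obtain i where i: "i < ?n" "v = vs ! i"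
      by (metis in_set_conv_nth)
    define j where "j = (if i = 0 then ?n - 1 else i - 1)"
    define k where "k = (if Suc i = ?n then 0 else Suc i)"
    have k: "Suc i mod ?n = k" "k < ?n" using i by (auto simp: k_def)
    have j: "j < ?n" "Suc j mod ?n = i" using i n by (auto simp: j_def)
    have ne: "j \<noteq> k" "i \<noteq> j" "i \<noteq> k" using i n by (auto simp: j_def k_def split: if_splits)
    have uniq: "l = j" if "l < ?n" "Suc l mod ?n = i" for l
      using that i n by (cases "Suc l = ?n") (auto simp: j_def)
    have idx: "v = vs ! l \<longleftrightarrow> l = i" if "l < ?n" for l
      using that i d nth_eq_iff_index_eq by fastforce
    have iff: "v \<in> {vs ! l, vs ! (Suc l mod ?n)} \<longleftrightarrow> l = i \<or> l = j" if "l < ?n" for l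
    proof -
      have "Suc l mod ?n < ?n" using n by (intro mod_less_divisor) linarith
      then show ?thesis using idx[OF that] idx[of "Suc l mod ?n"] uniq[OF that] j by auto
    qed
    have "{e \<in> edges C. v \<in> e} = {{vs ! i, vs ! k}, {vs ! j, vs ! i}}"
    proof (intro equalityI subsetI)
      fix e assume "e \<in> {e \<in> edges C. v \<in> e}"
      then obtain l where "l < ?n" "e = {vs ! l, vs ! (Suc l mod ?n)}" "v \<in> e"
        unfolding E by blast
      with iff[of l] j k show "e \<in> {{vs ! i, vs ! k}, {vs ! j, vs ! i}}" by auto
    next
      fix e assume "e \<in> {{vs ! i, vs ! k}, {vs ! j, vs ! i}}"
      then consider "e = {vs ! i, vs ! (Suc i mod ?n)}" | "e = {vs ! j, vs ! (Suc j mod ?n)}"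
        using j k by auto
      then show "e \<in> {e \<in> edges C. v \<in> e}"
        by cases (use i j in \<open>auto simp: E\<close>)
    qed
    moreover have "vs ! j \<noteq> vs ! k" "vs ! i \<noteq> vs ! j" "vs ! i \<noteq> vs ! k"
      using d i j k ne by (simp_all add: nth_eq_iff_index_eq)
    then have "card {{vs ! i, vs ! k}, {vs ! j, vs ! i}} = 2"
      by (auto simp: card_2_iff doubleton_eq_iff)
    ultimately show ?thesis by simp
  next
    case False
    then have "{e \<in> edges C. v \<in> e} = {}"
    proof -
      have "e \<subseteq> set vs" if "e \<in> edges C" for e
      proof -
        from that obtain l where "l < ?n" "e = {vs ! l, vs ! (Suc l mod ?n)}"
          unfolding E by blast
        moreover have "Suc l mod ?n < ?n" using n by (intro mod_less_divisor) linarith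
        ultimately show ?thesis by simp
      qed
      then show ?thesis using False by blast
    qed
    then show ?thesis by (simp only: card.empty even_zero)
  qed
  then show ?thesis
    using G sub
    by (auto simp: even_subgraph_def spanning_subgraph_def subgraph_def as_spanning_def
        ugraph_def degree_def)
qed

text \<open>
  The symmetric difference of two spanning subgraphs of \<open>G\<close>, and its iteration over a finite
  collection, given as a list; the empty list yields the spanning subgraph without edges.
\<close>

definition graph_sym_diff :: "'a ugraph \<Rightarrow> 'a ugraph \<Rightarrow> 'a ugraph \<Rightarrow> 'a ugraph" where
  "graph_sym_diff G H K =
     \<lparr>verts = verts G, edges = (edges H - edges K) \<union> (edges K - edges H)\<rparr>"

definition graph_sym_diffs :: "'a ugraph \<Rightarrow> 'a ugraph list \<Rightarrow> 'a ugraph" where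
  "graph_sym_diffs G Hs = foldr (graph_sym_diff G) Hs \<lparr>verts = verts G, edges = {}\<rparr>"

section \<open>The graph of a polytope\<close>

text \<open>
  Faces of a polytope are the exposed faces of the library. Besides being cut out by a
  supporting hyperplane, these are required there to be faces in the sense of \<open>face_of\<close>,
  which is automatic; the next lemma shows that nothing changes.
\<close>

lemma exposed_face_of_polytope_iff:
  fixes P :: "'a::euclidean_space set"
  assumes "polytope P"
  shows "F exposed_face_of P \<longleftrightarrow>
    F = P \<or> (\<exists>a b. a \<noteq> 0 \<and> P \<subseteq> {x. a \<bullet> x \<le> b} \<and> F = P \<inter> {x. a \<bullet> x = b})"
    (is "?L \<longleftrightarrow> ?R")
proof
  assume ?L
  then consider "F = {}" | "F = P"
    | "\<exists>a b. a \<noteq> 0 \<and> P \<subseteq> {x. a \<bullet> x \<le> b} \<and> F = P \<inter> {x. a \<bullet> x = b}"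
    unfolding exposed_face_of by blast
  then show ?R
  proof cases
    case 1
    obtain B where B: "\<And>x. x \<in> P \<Longrightarrow> norm x \<le> B"
      using polytope_imp_bounded[OF assms] by (auto simp: bounded_iff)
    obtain a :: 'a where a: "norm a = 1"
      using vector_choose_size[of 1] by auto
    have "a \<bullet> x < B + 1" if "x \<in> P" for x
      using norm_cauchy_schwarz[of a x] B[OF that] a by simp
    then have "P \<subseteq> {x. a \<bullet> x \<le> B + 1}" "F = P \<inter> {x. a \<bullet> x = B + 1}"
      using 1 by (force intro: less_imp_le)+
    moreover have "a \<noteq> 0" using a by auto
    ultimately show ?thesis by blast
  qed auto
next
  assume ?R
  then show ?L
    using exposed_face_of_refl[OF polytope_imp_convex[OF assms]]
      exposed_face_of_Int_supporting_hyperplane_le[OF polytope_imp_convex[OF assms]]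
    by blast
qed

definition face_of_dim :: "int \<Rightarrow> 'a::euclidean_space set \<Rightarrow> 'a set \<Rightarrow> bool" where
  "face_of_dim k F P \<longleftrightarrow> F exposed_face_of P \<and> aff_dim F = k"

text \<open>
  A 0-dimensional face \<open>{v}\<close> is identified with the point \<open>v\<close>, and a 1-dimensional face with
  the set of vertices of \<open>P\<close> that it contains, that is, with its two endpoints.
\<close>

definition vertices_of :: "'a::euclidean_space set \<Rightarrow> 'a set" where
  "vertices_of P = {v. face_of_dim 0 {v} P}"

definition polytope_graph :: "'a::euclidean_space set \<Rightarrow> 'a ugraph" where
  "polytope_graph P =
     \<lparr>verts = vertices_of P, edges = {vertices_of P \<inter> e | e. face_of_dim 1 e P}\<rparr>"

lemma exposed_face_of_polytope: "polytope P \<Longrightarrow> F exposed_face_of P \<longleftrightarrow> F face_of P"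
  by (simp add: exposed_face_of_polyhedron polytope_imp_polyhedron)

lemma vertices_of_segment_face:
  fixes P :: "'a::euclidean_space set"
  assumes P: "polytope P" and ab: "closed_segment a b face_of P"
  shows "vertices_of P \<inter> closed_segment a b = {a, b}"
proof -
  have "v \<in> vertices_of P \<longleftrightarrow> v = a \<or> v = b" if v: "v \<in> closed_segment a b" for v
  proof -
    have "v \<in> vertices_of P \<longleftrightarrow> {v} face_of P"
      by (simp add: vertices_of_def face_of_dim_def exposed_face_of_polytope[OF P])
    also have "\<dots> \<longleftrightarrow> {v} face_of closed_segment a b"
      using face_of_face[OF ab, of "{v}"] v by auto
    also have "\<dots> \<longleftrightarrow> v = a \<or> v = b"
      by (simp add: face_of_singleton extreme_point_of_segment)
    finally show ?thesis .
  qed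
  then show ?thesis by auto
qed

lemma edges_polytope_graph:
  fixes P :: "'a::euclidean_space set"
  assumes P: "polytope P"
  shows "edges (polytope_graph P) =
    {{a, b} | a b. a \<noteq> b \<and> closed_segment a b exposed_face_of P}" (is "?L = ?R")
proof
  show "?L \<subseteq> ?R"
  proof
    fix x assume "x \<in> ?L"
    then obtain e where x: "x = vertices_of P \<inter> e" and e: "e face_of P" "aff_dim e = 1"
      by (auto simp: polytope_graph_def face_of_dim_def exposed_face_of_polytope[OF P])
    have "polytope e" using e P face_of_polytope_polytope by blast
    moreover have "collinear e" using e by (simp add: collinear_aff_dim)
    moreover have "e \<noteq> {}" using e by auto
    ultimately obtain a b where ab: "e = closed_segment a b"
      using compact_convex_collinear_segment polytope_imp_compact polytope_imp_convex by metis
    moreover have "a \<noteq> b" using e ab by auto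
    ultimately show "x \<in> ?R"
      using x e vertices_of_segment_face[OF P] exposed_face_of_polytope[OF P] by blast
  qed
  show "?R \<subseteq> ?L"
  proof
    fix x assume "x \<in> ?R"
    then obtain a b where x: "x = {a, b}" "a \<noteq> b" and ab: "closed_segment a b face_of P"
      by (auto simp: exposed_face_of_polytope[OF P])
    have "aff_dim (closed_segment a b) = 1"
      using x(2) by (simp add: segment_convex_hull aff_dim_convex_hull)
    then have "face_of_dim 1 (closed_segment a b) P"
      using ab by (simp add: face_of_dim_def exposed_face_of_polytope[OF P])
    moreover have "x = vertices_of P \<inter> closed_segment a b"
      using vertices_of_segment_face[OF P ab] x(1) by simp
    ultimately show "x \<in> ?L"
      unfolding polytope_graph_def by auto
  qed
qed

lemma ugraph_polytope_graph: "polytope P \<Longrightarrow> ugraph (polytope_graph P)"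
proof -
  assume P: "polytope P"
  have "{a, b} \<subseteq> verts (polytope_graph P)" if "closed_segment a b exposed_face_of P" for a b
    using vertices_of_segment_face[OF P] that
    by (auto simp: exposed_face_of_polytope[OF P] polytope_graph_def)
  then show ?thesis
    unfolding ugraph_def edges_polytope_graph[OF P] by (auto simp: card_2_iff)
qed

text \<open>
  A 2-face \<open>F\<close> is itself a polytope, so the subgraph formed by its vertices and edges is its
  own graph.
\<close>

definition facial_cycle :: "'a::euclidean_space set \<Rightarrow> 'a ugraph \<Rightarrow> bool" where
  "facial_cycle P C \<longleftrightarrow>
     cycle_in C (polytope_graph P) \<and> (\<exists>F. face_of_dim 2 F P \<and> C = polytope_graph F)"

end

theory Submission
  imports Defs
begin

text \<open>
  Sweep the polytope with a generic linear functional \<open>c\<close>. Order the edges by the height of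
  their upper end; edges with the same upper end \<open>v\<close> are ordered by their slope, the quotient of
  \<open>c\<close> and a functional exposing \<open>v\<close>. By genericity this is a total order. The even edge sets
  form a vector space over the two-element field with symmetric difference as addition, and
  it suffices to show that the last edge of every nonempty even set is also the last edge
  of some facial cycle: adding that cycle removes the edge and brings in only earlier ones, so Gaussian
  elimination (\<open>eliminate_leading_edges\<close>) ends with the empty set.
  
  Let \<open>e\<close> be the last edge of an even set and \<open>v\<close> its upper end. The set has a second edge
  at \<open>v\<close>; it is earlier than \<open>e\<close>, so it also goes down, and more steeply. So \<open>e\<close> is not the
  steepest edge at \<open>v\<close>. The edges at \<open>v\<close> correspond to the vertices of the vertex figure at \<open>v\<close>,
  on which the slope is a linear functional, and a vertex not minimising a linear functional has a lower
  neighbour; that is, some 2-face contains \<open>e\<close> and a steeper edge at \<open>v\<close>. The lemma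
  \<open>descending_face\<close> proves this statement directly, without vertex figures. Both edges of
  this 2-face at \<open>v\<close> go down, so \<open>v\<close> is its highest vertex and \<open>e\<close> is the last edge of its boundary
  (\<open>last_edge_has_facial_cycle\<close>).
  
  It remains to know that the graph of a polygon is a cycle (\<open>polygon_graph_cycle\<close>). Every vertex
  of a polygon has exactly two neighbours, the graph is connected since any vertex but
  the lowest has a lower neighbour, and a finite connected graph with all degrees two is a cycle.
\<close>

section \<open>Local improvement on faces\<close>

text \<open>
  A proper nonempty face lies in a facet; going down through facets of facets, the dimension drops
  by one at each step until the face itself is the next facet.
\<close>

lemma face_one_dim_higher:
  fixes G :: "'a::euclidean_space set"
  assumes "polytope G" "F face_of G" "F \<noteq> {}" "F \<noteq> G"
  obtains K where "K face_of G" "F \<subseteq> K" "aff_dim K = aff_dim F + 1"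
proof -
  have "\<exists>K. K face_of G \<and> F \<subseteq> K \<and> aff_dim K = aff_dim F + 1"
    using assms
  proof (induction "nat (aff_dim G)" arbitrary: G rule: less_induct)
    case less
    obtain K where K: "K facet_of G" "F \<subseteq> K"
      using face_of_polyhedron_subset_facet[OF polytope_imp_polyhedron] less.prems by metis
    have KG: "K face_of G" and dK: "aff_dim K = aff_dim G - 1"
      using K by (auto simp: facet_of_def)
    show ?case
    proof (cases "K = F")
      case True
      with dK less.prems have "aff_dim G = aff_dim F + 1" by simp
      then show ?thesis
        using face_of_refl[OF polytope_imp_convex] face_of_imp_subset less.prems by blast
    next
      case False
      have FK: "F face_of K"
        using face_of_face[OF KG] K less.prems by blast
      have "aff_dim K \<ge> 0"
        using K aff_dim_negative_iff[of K] by (auto simp: facet_of_def)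
      then have "nat (aff_dim K) < nat (aff_dim G)" using dK by simp
      then obtain L where "L face_of K" "F \<subseteq> L" "aff_dim L = aff_dim F + 1"
        using less.hyps[of K] face_of_polytope_polytope[OF less.prems(1) KG] FK less.prems(3) False
        by metis
      then show ?thesis using KG face_of_trans by blast
    qed
  qed
  then show thesis using that by blast
qed

lemma polytope_halfspace_from_vertices:
  fixes P :: "'a::euclidean_space set"
  assumes "polytope P" and "\<And>x. x extreme_point_of P \<Longrightarrow> h \<le> g \<bullet> x" and "x \<in> P"
  shows "h \<le> g \<bullet> x"
proof -
  have "P = convex hull {x. x extreme_point_of P}"
    using Krein_Milman_Minkowski polytope_imp_compact polytope_imp_convex assms(1) by blast
  also have "\<dots> \<subseteq> {x. g \<bullet> x \<ge> h}"
    using assms(2) by (intro hull_minimal) (auto simp: convex_halfspace_ge)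
  finally show ?thesis using assms(3) by blast
qed

lemma finite_extreme_points_polytope:
  fixes P :: "'a::euclidean_space set"
  shows "polytope P \<Longrightarrow> finite {v. v extreme_point_of P}"
  by (simp add: finite_polyhedron_extreme_points polytope_imp_polyhedron)

lemma face_polytope_exposed:
  fixes P :: "'a::euclidean_space set"
  assumes "polytope P" "F face_of P"
  obtains a b where "\<And>x. x \<in> P \<Longrightarrow> b \<le> a \<bullet> x" "\<And>x. x \<in> P \<Longrightarrow> x \<in> F \<longleftrightarrow> a \<bullet> x = b"
proof -
  from assms have "F exposed_face_of P" by (simp add: exposed_face_of_polytope)
  then obtain a b where "P \<subseteq> {x. a \<bullet> x \<le> b}" "F = P \<inter> {x. a \<bullet> x = b}"
    unfolding exposed_face_of_def by blast
  then show thesis by (intro that[of "-b" "-a"]) auto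
qed

text \<open>
  This is the ``local improvement'' principle of the simplex method, for a face in place of a
  vertex: a functional that is constant on \<open>F\<close> and takes a smaller value somewhere on the
  polytope takes a smaller value already on a face just one dimension above \<open>F\<close>. For
  \<open>F\<close> a vertex it finds a descending edge; for \<open>F\<close> an edge it finds the 2-faces from
  which the facial cycles are made. Let \<open>a\<close> expose \<open>F\<close> and minimise the quotient of the
  two functionals, measured from their values on \<open>F\<close>, over the vertices outside \<open>F\<close>. The
  points of the polytope that attain the minimal quotient form, together with \<open>F\<close>, a face, and
  on it the first functional is a negative multiple of the second. Quotients play the role of a linear
  functional on the polytope of directions at \<open>F\<close>, which is thus never constructed.
\<close>

lemma descending_face:
  fixes P :: "'a::euclidean_space set"
  assumes P: "polytope P" and F: "F face_of P" "F \<noteq> {}"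
    and zero: "\<And>x. x \<in> F \<Longrightarrow> g \<bullet> x = h"
    and neg: "x0 \<in> P" "g \<bullet> x0 < h"
  obtains K where "K face_of P" "F \<subseteq> K" "aff_dim K = aff_dim F + 1"
    "\<And>x. x \<in> K - F \<Longrightarrow> g \<bullet> x < h"
proof -
  obtain a b where ab: "\<And>x. x \<in> P \<Longrightarrow> b \<le> a \<bullet> x" "\<And>x. x \<in> P \<Longrightarrow> x \<in> F \<longleftrightarrow> a \<bullet> x = b"
    using face_polytope_exposed[OF P F(1)] by metis
  define V where "V = {x. x extreme_point_of P} - F"
  define q where "q x = (g \<bullet> x - h) / (a \<bullet> x - b)" for x
  have finV: "finite V"
    unfolding V_def using finite_extreme_points_polytope[OF P] by simp
  have pos: "a \<bullet> x - b > 0" if "x \<in> P - F" for x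
    using ab[of x] that by force
  have VP: "V \<subseteq> P - F" unfolding V_def by (auto simp: extreme_point_of_def)
  obtain y where y: "y extreme_point_of P" "g \<bullet> y < h"
    using polytope_halfspace_from_vertices[OF P, of h g x0] neg by force
  then have yV: "y \<in> V" using zero by (force simp: V_def)
  define m where "m = Min (q ` V)"
  have m_le: "m \<le> q x" if "x \<in> V" for x
    unfolding m_def using finV that by simp
  have "m \<in> q ` V" unfolding m_def using finV yV by (intro Min_in) auto
  then obtain w where w: "w \<in> V" "m = q w" by blast
  have "q y < 0"
    using y(2) pos[of y] yV VP by (auto simp: q_def divide_neg_pos)
  then have m0: "m < 0" using m_le[OF yV] by simp
  define g' where "g' = g - m *\<^sub>R a"
  have g': "g' \<bullet> x - (h - m * b) = (g \<bullet> x - h) - m * (a \<bullet> x - b)" for x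
    by (simp add: g'_def inner_diff_left algebra_simps)
  \<comment> \<open>Minimality of the quotient says that subtracting \<open>m\<close> times the exposing functional
    leaves a functional that is nonnegative on all vertices.\<close>
  have ge: "h - m * b \<le> g' \<bullet> x" if "x \<in> P" for x
  proof (rule polytope_halfspace_from_vertices[OF P _ that])
    fix x assume x: "x extreme_point_of P"
    then have xP: "x \<in> P" by (simp add: extreme_point_of_def)
    have "0 \<le> (g \<bullet> x - h) - m * (a \<bullet> x - b)"
    proof (cases "x \<in> F")
      case True
      then show ?thesis using zero[of x] ab(2)[OF xP] by simp
    next
      case False
      then have "m \<le> q x" "a \<bullet> x - b > 0" using m_le pos[of x] x xP by (auto simp: V_def)
      then show ?thesis by (simp add: q_def pos_le_divide_eq)
    qed
    then show "h - m * b \<le> g' \<bullet> x" using g'[of x] by simp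
  qed
  define G where "G = P \<inter> {x. g' \<bullet> x = h - m * b}"
  have GP: "G face_of P"
    unfolding G_def using face_of_Int_supporting_hyperplane_ge[OF polytope_imp_convex[OF P] ge] .
  have onG: "g \<bullet> x - h = m * (a \<bullet> x - b)" if "x \<in> G" for x
    using that g'[of x] by (simp add: G_def)
  have FG: "F \<subseteq> G"
  proof
    fix x assume x: "x \<in> F"
    then have xP: "x \<in> P" using F(1) face_of_imp_subset by blast
    then have "g' \<bullet> x - (h - m * b) = 0" using g'[of x] zero[OF x] ab(2)[OF xP] x by simp
    then show "x \<in> G" using xP by (simp add: G_def)
  qed
  have "w \<in> G"
  proof -
    have "a \<bullet> w - b > 0" "w \<in> P" using pos[of w] w VP by auto
    then have "g' \<bullet> w - (h - m * b) = 0" using g'[of w] w(2) by (simp add: q_def)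
    then show ?thesis using \<open>w \<in> P\<close> by (simp add: G_def)
  qed
  then have "F \<noteq> G" using w by (auto simp: V_def)
  moreover have "F face_of G" using face_of_face[OF GP] F(1) FG by blast
  ultimately obtain K where K: "K face_of G" "F \<subseteq> K" "aff_dim K = aff_dim F + 1"
    using face_one_dim_higher[OF face_of_polytope_polytope[OF P GP] _ F(2)] by metis
  show thesis
  proof (rule that[of K])
    show "K face_of P" using K(1) GP face_of_trans by blast
    fix x assume x: "x \<in> K - F"
    then have xG: "x \<in> G" using K(1) face_of_imp_subset by blast
    then have "a \<bullet> x - b > 0" using pos[of x] x by (auto simp: G_def)
    then have "m * (a \<bullet> x - b) < 0" using m0 by (simp add: mult_neg_pos)
    then show "g \<bullet> x < h" using onG[OF xG] by simp
  qed (use K in auto)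
qed

section \<open>Adjacency of vertices\<close>

definition adjacent :: "'a::euclidean_space set \<Rightarrow> 'a \<Rightarrow> 'a \<Rightarrow> bool" where
  "adjacent P u v \<longleftrightarrow> u \<noteq> v \<and> closed_segment u v face_of P"

lemma adjacent_sym: "adjacent P u v \<longleftrightarrow> adjacent P v u"
  by (auto simp: adjacent_def closed_segment_commute)

lemma adjacent_extreme:
  assumes "adjacent P u v"
  shows "u extreme_point_of P" "v extreme_point_of P"
  using assms extreme_point_of_face[of "closed_segment u v" P]
  by (auto simp: adjacent_def extreme_point_of_segment)

lemma vertices_of_eq_extreme: "polytope P \<Longrightarrow> vertices_of P = {v. v extreme_point_of P}"
  by (simp add: vertices_of_def face_of_dim_def exposed_face_of_polytope face_of_singleton)

lemma edges_eq_adjacent: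
  "polytope P \<Longrightarrow> edges (polytope_graph P) = {{u, v} | u v. adjacent P u v}"
  by (simp add: edges_polytope_graph exposed_face_of_polytope adjacent_def)

lemma doubleton_edge_iff:
  "polytope P \<Longrightarrow> {u, v} \<in> edges (polytope_graph P) \<longleftrightarrow> adjacent P u v"
  by (auto simp: edges_eq_adjacent doubleton_eq_iff adjacent_sym)

lemma edge_at_vertex:
  assumes P: "polytope P" and e: "e \<in> edges (polytope_graph P)" "v \<in> e"
  obtains u where "e = {v, u}" "adjacent P v u"
proof -
  obtain x y where xy: "e = {x, y}" "adjacent P x y"
    using e(1) by (auto simp: edges_eq_adjacent[OF P])
  show thesis
  proof (cases "v = x")
    case True
    then show thesis using that xy by blast
  next
    case False
    then have "v = y" using e(2) xy(1) by blast
    then show thesis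
      using that[of x] xy adjacent_sym[of P x y] by (simp add: insert_commute)
  qed
qed

lemma adjacent_face:
  "K face_of P \<Longrightarrow> adjacent K u v \<longleftrightarrow> adjacent P u v \<and> closed_segment u v \<subseteq> K"
  by (auto simp: adjacent_def face_of_face)

lemma one_face_at_vertex:
  fixes P :: "'a::euclidean_space set"
  assumes P: "polytope P" and K: "K face_of P" "aff_dim K = 1" and v: "v extreme_point_of P" "v \<in> K"
  obtains u where "adjacent P v u" "K = closed_segment v u"
proof -
  have pK: "polytope K" using face_of_polytope_polytope P K by blast
  moreover have "collinear K" using K by (simp add: collinear_aff_dim)
  ultimately obtain a b where ab: "K = closed_segment a b"
    using v compact_convex_collinear_segment polytope_imp_compact polytope_imp_convex
    by (metis empty_iff)
  have "a \<noteq> b" using K ab by auto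
  have "v = a \<or> v = b"
    using extreme_point_of_face[OF K(1)] v ab by (simp add: extreme_point_of_segment)
  then show thesis
  proof
    assume "v = a"
    then show thesis using that[of b] ab \<open>a \<noteq> b\<close> K(1) by (simp add: adjacent_def)
  next
    assume "v = b"
    then show thesis
      using that[of a] ab \<open>a \<noteq> b\<close> K(1) by (simp add: adjacent_def closed_segment_commute)
  qed
qed

lemma descending_edge:
  fixes P :: "'a::euclidean_space set"
  assumes P: "polytope P" and v: "v extreme_point_of P" and x0: "x0 \<in> P" "g \<bullet> x0 < g \<bullet> v"
  obtains u where "adjacent P v u" "g \<bullet> u < g \<bullet> v"
proof -
  obtain K where K: "K face_of P" "{v} \<subseteq> K" "aff_dim K = aff_dim {v} + 1"
    "\<And>x. x \<in> K - {v} \<Longrightarrow> g \<bullet> x < g \<bullet> v"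
    using descending_face[OF P _ _ _ x0, of "{v}"] v by (auto simp: face_of_singleton)
  then obtain u where u: "adjacent P v u" "K = closed_segment v u"
    using one_face_at_vertex[OF P K(1) _ v] by auto
  then have "g \<bullet> u < g \<bullet> v" using K(4)[of u] by (auto simp: adjacent_def)
  then show thesis using that u by blast
qed

section \<open>Generic functionals and connectedness\<close>

text \<open>
  Every condition excludes a null set (a hyperplane) of functionals, and there are finitely many.
\<close>

lemma generic_functional:
  fixes d :: "'i \<Rightarrow> 'a::euclidean_space"
  assumes "finite I" "\<And>i. i \<in> I \<Longrightarrow> d i \<noteq> 0"
  shows "\<exists>c. \<forall>i\<in>I. c \<bullet> d i \<noteq> 0"
proof -
  have "negligible (\<Union>i\<in>I. {x. d i \<bullet> x = 0})"
    using assms by (intro negligible_Union) (auto intro!: negligible_hyperplane)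
  then have "(\<Union>i\<in>I. {x. d i \<bullet> x = 0}) \<noteq> UNIV"
    using non_negligible_UNIV by metis
  then show ?thesis by (auto simp: inner_commute)
qed

lemma injective_functional:
  fixes V :: "'a::euclidean_space set"
  assumes "finite V"
  shows "\<exists>c. inj_on ((\<bullet>) c) V"
proof -
  let ?I = "{p \<in> V \<times> V. fst p \<noteq> snd p}"
  have "finite ?I" using assms by simp
  then obtain c where "\<forall>p\<in>?I. c \<bullet> (fst p - snd p) \<noteq> 0"
    using generic_functional[of ?I "\<lambda>p. fst p - snd p"] by auto
  then show ?thesis
    by (intro exI[of _ c]) (force simp: inj_on_def inner_diff_right)
qed

text \<open>
  The graph of a polytope is connected, in the form that a nonempty set of vertices that is closed
  under adjacency contains all vertices. Choose a functional that separates the vertices. The lowest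
  point of a set closed under adjacency has no lower neighbour, so it is the lowest point of the
  polytope; hence such a set and its complement cannot both be nonempty.
\<close>

lemma neighbour_closed_all:
  fixes P :: "'a::euclidean_space set"
  assumes P: "polytope P" and R: "R \<subseteq> {v. v extreme_point_of P}" "R \<noteq> {}"
    and closed: "\<And>u v. u \<in> R \<Longrightarrow> adjacent P u v \<Longrightarrow> v \<in> R"
  shows "R = {v. v extreme_point_of P}"
proof (rule ccontr)
  let ?V = "{v. v extreme_point_of P}"
  assume "R \<noteq> ?V"
  then have R': "?V - R \<noteq> {}" using R by blast
  have finV: "finite ?V" using finite_extreme_points_polytope[OF P] .
  obtain c where c: "inj_on ((\<bullet>) c) ?V" using injective_functional[OF finV] by blast
  have bottom: "\<exists>v\<in>S. \<forall>x\<in>P. c \<bullet> v \<le> c \<bullet> x"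
    if S: "S \<subseteq> ?V" "S \<noteq> {}" "\<And>u v. u \<in> S \<Longrightarrow> adjacent P u v \<Longrightarrow> v \<in> S" for S
  proof -
    have "finite S" using S finV finite_subset by blast
    then obtain v where v: "v \<in> S" "\<And>u. u \<in> S \<Longrightarrow> c \<bullet> v \<le> c \<bullet> u"
      using S(2) arg_min_least[of S _ "(\<bullet>) c"] arg_min_if_finite(1)[of S "(\<bullet>) c"] by blast
    have "c \<bullet> v \<le> c \<bullet> x" if x: "x \<in> P" for x
    proof (rule ccontr)
      assume "\<not> ?thesis"
      then obtain u where "adjacent P v u" "c \<bullet> u < c \<bullet> v"
        using descending_edge[OF P _ x, of v c] v(1) S(1) by (metis mem_Collect_eq not_le subsetD)
      then show False using S(3) v by force
    qed
    then show ?thesis using v by blast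
  qed
  have "\<exists>v\<in>R. \<forall>x\<in>P. c \<bullet> v \<le> c \<bullet> x"
    using closed by (rule bottom[OF R])
  then obtain v where v: "v \<in> R" "\<forall>x\<in>P. c \<bullet> v \<le> c \<bullet> x" by blast
  have "y \<in> ?V - R" if "x \<in> ?V - R" "adjacent P x y" for x y
    using closed[of y x] that adjacent_sym[of P x y] adjacent_extreme(2)[OF that(2)] by auto
  then have "\<exists>u\<in>?V - R. \<forall>x\<in>P. c \<bullet> u \<le> c \<bullet> x"
    by (rule bottom[OF Diff_subset R'])
  then obtain u where u: "u \<in> ?V - R" "\<forall>x\<in>P. c \<bullet> u \<le> c \<bullet> x" by blast
  have "u \<in> P" "v \<in> P" "u \<in> ?V" "v \<in> ?V" "u \<noteq> v"
    using u(1) v(1) R(1) by (auto simp: extreme_point_of_def)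
  moreover from this have "c \<bullet> u = c \<bullet> v" using u(2) v(2) by (simp add: order_antisym)
  ultimately show False using inj_onD[OF c] by metis
qed

section \<open>Polygons are bounded by cycles\<close>

lemma maximal_path:
  assumes fin: "finite V" and p: "is_path p"
    and bound: "\<And>vs. is_path vs \<Longrightarrow> distinct vs \<and> set vs \<subseteq> V"
  shows "\<exists>vs. is_path vs \<and> length p \<le> length vs \<and> (\<forall>ws. is_path ws \<longrightarrow> length ws \<le> length vs)"
proof -
  have "length ws < Suc (card V)" if "is_path ws" for ws
    using bound[OF that] card_mono[OF fin, of "set ws"] distinct_card[of ws] by simp
  then obtain vs where "is_path vs" "\<forall>ws. is_path ws \<longrightarrow> length ws \<le> length vs"
    using ex_has_greatest_nat[of is_path p length "Suc (card V)"] p by blast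
  then show ?thesis using p by blast
qed

text \<open>
  The first vertex of a longest path has a second neighbour, which is on the path by maximality. It
  must be the last vertex, since an inner vertex would have three neighbours. So the path closes up
  to a cycle; as its vertices have no neighbours besides those on the cycle, connectedness makes it
  the whole graph.
\<close>

lemma two_regular_connected_cycle:
  fixes adj :: "'a \<Rightarrow> 'a \<Rightarrow> bool"
  assumes fin: "finite V" and ne: "V \<noteq> {}"
    and sym: "\<And>u v. adj u v \<Longrightarrow> adj v u" and irr: "\<And>u. \<not> adj u u"
    and inV: "\<And>u v. adj u v \<Longrightarrow> v \<in> V"
    and two: "\<And>u. u \<in> V \<Longrightarrow> card {v. adj u v} = 2"
    and conn: "\<And>R. R \<subseteq> V \<Longrightarrow> R \<noteq> {} \<Longrightarrow> (\<And>u v. u \<in> R \<Longrightarrow> adj u v \<Longrightarrow> v \<in> R) \<Longrightarrow> R = V"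
  shows "cycle_graph \<lparr>verts = V, edges = {{u, v} | u v. adj u v}\<rparr>"
proof -
  have nbrs: "{w. adj u w} = {a, b}" if "adj u a" "adj u b" "a \<noteq> b" for u a b
  proof -
    have "card {w. adj u w} = 2" using two inV[OF sym[OF that(1)]] by blast
    moreover from this have "finite {w. adj u w}" using card.infinite by fastforce
    ultimately show ?thesis
      using card_subset_eq[of "{w. adj u w}" "{a, b}"] that by auto
  qed
  define is_path where "is_path vs \<longleftrightarrow> distinct vs \<and> set vs \<subseteq> V \<and>
    (\<forall>i. Suc i < length vs \<longrightarrow> adj (vs ! i) (vs ! Suc i))" for vs
  obtain v where "v \<in> V" using ne by blast
  then obtain a b where ab: "{w. adj v w} = {a, b}" "a \<noteq> b"
    using two[OF \<open>v \<in> V\<close>] unfolding card_2_iff by blast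
  then have "adj v a" "adj v b" by auto
  then have "distinct [a, v, b]" "set [a, v, b] \<subseteq> V" "adj a v"
    using ab(2) irr[of v] inV \<open>v \<in> V\<close> sym[of v a] by auto
  moreover have "i = 0 \<or> i = 1" if "Suc i < 3" for i :: nat using that by auto
  ultimately have "is_path [a, v, b]"
    using \<open>adj v b\<close> unfolding is_path_def by (auto simp: less_Suc_eq)
  then obtain vs where vs: "is_path vs" "3 \<le> length vs" "\<And>ws. is_path ws \<Longrightarrow> length ws \<le> length vs"
    using maximal_path[OF fin, of is_path "[a, v, b]"] \<open>is_path [a, v, b]\<close>
    by (auto simp: is_path_def)
  define n where "n = length vs"
  have n: "3 \<le> n" using vs(2) by (simp add: n_def)
  have dist: "distinct vs" and VV: "set vs \<subseteq> V"
    and step: "\<And>i. Suc i < n \<Longrightarrow> adj (vs ! i) (vs ! Suc i)"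
    using vs(1) by (auto simp: is_path_def n_def)
  have eq_iff: "vs ! i = vs ! j \<longleftrightarrow> i = j" if "i < n" "j < n" for i j
    using dist that by (simp add: n_def nth_eq_iff_index_eq)
  have v0: "vs ! 0 \<in> V"
  proof -
    have "0 < length vs" using vs(2) by linarith
    then show ?thesis using VV nth_mem by blast
  qed
  obtain y z where yz: "{w. adj (vs ! 0) w} = {y, z}" "y \<noteq> z"
    using two[OF v0] unfolding card_2_iff by blast
  then have "adj (vs ! 0) y" "adj (vs ! 0) z" by auto
  then have "\<exists>x. adj (vs ! 0) x \<and> x \<noteq> vs ! 1" using yz(2) by metis
  then obtain x where x: "adj (vs ! 0) x" "x \<noteq> vs ! 1" by blast
  have "x \<in> set vs"
  proof (rule ccontr)
    assume "x \<notin> set vs"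
    then have "is_path (x # vs)"
      unfolding is_path_def
    proof (intro conjI allI impI)
      fix i assume "Suc i < length (x # vs)"
      then show "adj ((x # vs) ! i) ((x # vs) ! Suc i)"
        using step[of "i - 1"] sym[OF x(1)] by (cases i) (auto simp: n_def)
    qed (use \<open>x \<notin> set vs\<close> dist VV inV[OF x(1)] in auto)
    then show False using vs(3)[of "x # vs"] by simp
  qed
  then obtain j where j: "j < n" "x = vs ! j" by (auto simp: n_def in_set_conv_nth)
  have "j \<noteq> 0" "j \<noteq> 1" using x j irr by (metis, metis)
  have "Suc j = n"
  proof (rule ccontr)
    assume "Suc j \<noteq> n"
    then have sj: "Suc j < n" using j by simp
    have "adj (vs ! j) (vs ! Suc j)" "adj (vs ! j) (vs ! (j - 1))" "adj (vs ! j) (vs ! 0)"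
      using step[OF sj] step[of "j - 1"] sym x j \<open>j \<noteq> 0\<close> by auto
    moreover have "vs ! Suc j \<noteq> vs ! (j - 1)" "vs ! Suc j \<noteq> vs ! 0" "vs ! (j - 1) \<noteq> vs ! 0"
      using eq_iff sj \<open>j \<noteq> 0\<close> \<open>j \<noteq> 1\<close> by auto
    moreover have "{w. adj (vs ! j) w} = {vs ! Suc j, vs ! (j - 1)}"
      using calculation by (intro nbrs) auto
    ultimately show False by (metis insert_iff mem_Collect_eq singletonD)
  qed
  have next_adj: "adj (vs ! i) (vs ! (Suc i mod n))" if "i < n" for i
  proof (cases "Suc i = n")
    case True
    then have "i = j" using \<open>Suc j = n\<close> by simp
    then show ?thesis using True x j sym by simp
  next
    case False
    then show ?thesis using step[of i] that by simp
  qed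
  have nbr_cases: "\<exists>k<n. (w = vs ! (Suc i mod n) \<and> k = i) \<or> (w = vs ! k \<and> Suc k mod n = i)"
    if i: "i < n" and w: "adj (vs ! i) w" for i w
  proof -
    define k where "k = (if i = 0 then n - 1 else i - 1)"
    have k: "k < n" "Suc k mod n = i" "k \<noteq> Suc i mod n"
      using i n by (auto simp: k_def mod_Suc)
    have "adj (vs ! i) (vs ! k)" using next_adj[OF k(1)] k(2) sym by simp
    moreover have "vs ! k \<noteq> vs ! (Suc i mod n)"
      using eq_iff[of k "Suc i mod n"] k i by simp
    ultimately have "w \<in> {vs ! k, vs ! (Suc i mod n)}"
      using nbrs[of "vs ! i" "vs ! k" "vs ! (Suc i mod n)"] next_adj[OF i] w by blast
    then show ?thesis using k i by blast
  qed
  have "set vs = V"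
  proof (rule conn[OF VV])
    show "set vs \<noteq> {}" using n by (auto simp: n_def)
    fix u w assume "u \<in> set vs" "adj u w"
    then obtain i where i: "i < n" "adj (vs ! i) w" by (auto simp: n_def in_set_conv_nth)
    obtain k where "k < n" "w = vs ! (Suc i mod n) \<or> w = vs ! k"
      using nbr_cases[OF i] by blast
    moreover have "Suc i mod n < n" using n by simp
    ultimately show "w \<in> set vs" by (auto simp: n_def)
  qed
  moreover have "{{u, v} | u v. adj u v} = {{vs ! i, vs ! (Suc i mod n)} | i. i < n}" (is "?L = ?R")
  proof
    show "?R \<subseteq> ?L" using next_adj by blast
    show "?L \<subseteq> ?R"
    proof
      fix e assume "e \<in> ?L"
      then obtain u w where uw: "e = {u, w}" "adj u w" by blast
      then have "u \<in> set vs" using inV sym \<open>set vs = V\<close> by blast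
      then obtain i where i: "i < n" "u = vs ! i" by (auto simp: n_def in_set_conv_nth)
      obtain k where k: "k < n" "(w = vs ! (Suc i mod n) \<and> k = i) \<or> (w = vs ! k \<and> Suc k mod n = i)"
        using nbr_cases[OF i(1)] uw i by blast
      then have "e = {vs ! k, vs ! (Suc k mod n)}" using uw i by auto
      then show "e \<in> ?R" using k(1) by blast
    qed
  qed
  ultimately show ?thesis
    unfolding cycle_graph_def using dist n by (intro exI[of _ vs]) (auto simp: n_def)
qed

lemma neighbour_not_on_edge:
  assumes "adjacent K v y" "adjacent K v z" "y \<noteq> z"
  shows "y \<notin> closed_segment v z"
  using assms adjacent_extreme(2)[OF assms(1)] extreme_point_of_face[of "closed_segment v z" K y]
  by (auto simp: adjacent_def extreme_point_of_segment)

text \<open>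
  A functional exposing the edge from \<open>v\<close> to \<open>u\<close> vanishes in the direction \<open>u - v\<close> and is positive
  towards all points of the polytope off that edge.
\<close>

lemma polygon_coordinate_pos:
  fixes K :: "'a::euclidean_space set"
  assumes K: "polytope K" and u: "adjacent K v u" and w: "w \<in> K" "w \<notin> closed_segment v u"
    and x: "x \<in> K" "x \<notin> closed_segment v u" "x - v = p *\<^sub>R (u - v) + q *\<^sub>R (w - v)"
  shows "q > 0"
proof -
  have F: "closed_segment v u face_of K" using u by (simp add: adjacent_def)
  obtain a b where ab: "\<And>y. y \<in> K \<Longrightarrow> b \<le> a \<bullet> y"
      "\<And>y. y \<in> K \<Longrightarrow> y \<in> closed_segment v u \<longleftrightarrow> a \<bullet> y = b"
    using face_polytope_exposed[OF K F] by metis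
  have "a \<bullet> v = b" "a \<bullet> u = b"
    using ab(2) face_of_imp_subset[OF F] by (auto simp: subset_iff)
  moreover have "a \<bullet> w > b" "a \<bullet> x > b" using ab(1,2)[OF w(1)] ab(1,2)[OF x(1)] w x by auto
  moreover have "a \<bullet> (x - v) = a \<bullet> (p *\<^sub>R (u - v) + q *\<^sub>R (w - v))" using x(3) by simp
  ultimately have "0 < q * (a \<bullet> w - b)" "a \<bullet> w - b > 0"
    by (simp_all add: inner_diff_right inner_add_right)
  then show ?thesis by (simp add: zero_less_mult_iff)
qed

text \<open>
  A first edge at \<open>v\<close> exists by dimension reasons, and a second one by climbing away from the
  first. The direction of a third would have positive coordinates with respect to the first two,
  hence would cross the segment between the two neighbours. The third neighbour then is no vertex if
  it falls short of the crossing point, and otherwise the third edge is no face.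
\<close>

lemma polygon_two_neighbours:
  fixes K :: "'a::euclidean_space set"
  assumes K: "polytope K" "aff_dim K = 2" and v: "v extreme_point_of K"
  obtains u w where "u \<noteq> w" "{x. adjacent K v x} = {u, w}"
proof -
  have vK: "{v} face_of K" using v by (simp add: face_of_singleton)
  moreover have "{v} \<noteq> K" using K by auto
  ultimately obtain E where E: "E face_of K" "v \<in> E" "aff_dim E = 1"
    using face_one_dim_higher[OF K(1), of "{v}"] by auto
  then obtain u where u: "adjacent K v u" "E = closed_segment v u"
    using one_face_at_vertex[OF K(1)] v by metis
  obtain a b where ab: "\<And>y. y \<in> K \<Longrightarrow> b \<le> a \<bullet> y" "\<And>y. y \<in> K \<Longrightarrow> y \<in> E \<longleftrightarrow> a \<bullet> y = b"
    using face_polytope_exposed[OF K(1) E(1)] by metis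
  have EK: "E \<subseteq> K" using E face_of_imp_subset by blast
  then have av: "a \<bullet> v = b" and au: "a \<bullet> u = b" using ab(2) E u by auto
  have "E \<noteq> K" using E K by auto
  then obtain x0 where x0: "x0 \<in> K" "x0 \<notin> E" using EK by blast
  \<comment> \<open>The second edge rises with respect to the functional that exposes the first.\<close>
  have "(- a) \<bullet> x0 < (- a) \<bullet> v" using ab[OF x0(1)] x0 av by simp
  then obtain w where w: "adjacent K v w" "(- a) \<bullet> w < (- a) \<bullet> v"
    by (rule descending_edge[OF K(1) v x0(1)])
  have wK: "w \<in> K" and uK: "u \<in> K"
    using adjacent_extreme(2)[OF u(1)] adjacent_extreme(2)[OF w(1)]
    by (simp_all add: extreme_point_of_def)
  have "u \<noteq> w" using w(2) av au by auto
  have "affine hull {v, u} \<subseteq> {x. a \<bullet> x = b}"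
    using av au by (intro hull_minimal) (auto simp: affine_hyperplane)
  then have "w \<notin> affine hull {v, u}" using w(2) av by auto
  then have "aff_dim {w, v, u} = 2"
    using u(1) aff_dim_insert[of w "{v, u}"] by (simp add: adjacent_def aff_dim_2)
  then have full: "affine hull {w, v, u} = affine hull K"
    using K(2) aff_dim_eq_full_gen[of "{w, v, u}" K] wK uK EK E(2) by auto
  have "x \<in> {u, w}" if x: "adjacent K v x" for x
  proof (rule ccontr)
    assume nx: "x \<notin> {u, w}"
    have xext: "x extreme_point_of K" and vx: "v \<noteq> x"
      using adjacent_extreme(2)[OF x] x by (simp_all add: adjacent_def)
    then have xK: "x \<in> K" by (simp add: extreme_point_of_def)
    have "x \<in> affine hull {w, v, u}" using full xK hull_subset[of K affine] by blast
    then obtain \<alpha> \<beta> \<gamma> where x_eq: "x = \<alpha> *\<^sub>R w + \<beta> *\<^sub>R v + \<gamma> *\<^sub>R u"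
      and "\<alpha> + \<beta> + \<gamma> = 1"
      by (auto simp: affine_hull_3)
    then have "v = \<alpha> *\<^sub>R v + \<beta> *\<^sub>R v + \<gamma> *\<^sub>R v"
      by (metis scaleR_add_left scaleR_one)
    with x_eq have "x - v = (\<alpha> *\<^sub>R w + \<beta> *\<^sub>R v + \<gamma> *\<^sub>R u) - (\<alpha> *\<^sub>R v + \<beta> *\<^sub>R v + \<gamma> *\<^sub>R v)"
      by simp
    also have "\<dots> = \<gamma> *\<^sub>R (u - v) + \<alpha> *\<^sub>R (w - v)" by (simp add: algebra_simps)
    finally have xv: "x - v = \<gamma> *\<^sub>R (u - v) + \<alpha> *\<^sub>R (w - v)" .
    then have xv': "x - v = \<alpha> *\<^sub>R (w - v) + \<gamma> *\<^sub>R (u - v)" by (simp add: add.commute)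
    have "\<alpha> > 0"
      using polygon_coordinate_pos[OF K(1) u(1) wK _ xK _ xv]
        neighbour_not_on_edge[OF w(1) u(1)] neighbour_not_on_edge[OF x u(1)] nx \<open>u \<noteq> w\<close> by auto
    moreover have "\<gamma> > 0"
      using polygon_coordinate_pos[OF K(1) w(1) uK _ xK _ xv']
        neighbour_not_on_edge[OF u(1) w(1)] neighbour_not_on_edge[OF x w(1)] nx \<open>u \<noteq> w\<close> by auto
    ultimately have pos: "\<alpha> > 0" "\<gamma> > 0" "\<alpha> + \<gamma> > 0" by auto
    define r where "r = \<alpha> + \<gamma>"
    \<comment> \<open>The point where the ray from \<open>v\<close> through \<open>x\<close> crosses the segment from \<open>u\<close> to \<open>w\<close>.\<close>
    define y where "y = (1 - \<alpha> / r) *\<^sub>R u + (\<alpha> / r) *\<^sub>R w"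
    have r: "r > 0" using pos r_def by simp
    have yseg: "y \<in> open_segment u w"
      unfolding in_segment y_def using pos r \<open>u \<noteq> w\<close>
      by (auto intro!: exI[of _ "\<alpha> / r"] simp: r_def)
    have yK: "y \<in> K"
      using yseg uK wK polytope_imp_convex[OF K(1)] convex_contains_open_segment by blast
    have "r *\<^sub>R (y - v) = (r - \<alpha>) *\<^sub>R u + \<alpha> *\<^sub>R w - r *\<^sub>R v"
      using r by (simp add: y_def algebra_simps)
    also have "\<dots> = x - v" unfolding xv by (simp add: r_def algebra_simps)
    finally have ry: "x - v = r *\<^sub>R (y - v)" by simp
    show False
    proof (cases "r < 1")
      case True
      have "x = (1 - r) *\<^sub>R v + r *\<^sub>R y" using ry by (simp add: algebra_simps)
      moreover have "v \<noteq> y" using ry vx by auto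
      ultimately have "x \<in> open_segment v y" unfolding in_segment using True r by blast
      then show False using xext yK EK E(2) by (auto simp: extreme_point_of_def)
    next
      case False
      have "y - v = (1 / r) *\<^sub>R (x - v)" using ry r by simp
      then have "y = (1 - 1 / r) *\<^sub>R v + (1 / r) *\<^sub>R x" by (simp add: algebra_simps)
      then have "y \<in> closed_segment v x"
        unfolding in_segment using False r by (intro exI[of _ "1 / r"]) auto
      then have "u \<in> closed_segment v x"
        using face_ofD[OF _ yseg uK wK] x by (auto simp: adjacent_def)
      then show False using neighbour_not_on_edge[OF u(1) x] nx by auto
    qed
  qed
  then have "{x. adjacent K v x} = {u, w}" using u w by blast
  then show thesis using that \<open>u \<noteq> w\<close> by blast
qed

lemma polygon_graph_cycle:
  fixes K :: "'a::euclidean_space set"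
  assumes K: "polytope K" "aff_dim K = 2"
  shows "cycle_graph (polytope_graph K)"
proof -
  let ?V = "{v. v extreme_point_of K}"
  have "K = convex hull ?V"
    using Krein_Milman_Minkowski polytope_imp_compact polytope_imp_convex K(1) by blast
  moreover have "K \<noteq> {}" using K(2) by auto
  ultimately have "?V \<noteq> {}" by (metis convex_hull_empty)
  have "cycle_graph \<lparr>verts = ?V, edges = {{u, v} | u v. adjacent K u v}\<rparr>"
  proof (rule two_regular_connected_cycle)
    show "card {v. adjacent K u v} = 2" if "u \<in> ?V" for u
    proof -
      from that have "u extreme_point_of K" by simp
      then obtain a b where "a \<noteq> b" "{v. adjacent K u v} = {a, b}"
        by (rule polygon_two_neighbours[OF K])
      then show ?thesis by simp
    qed
    show "R = ?V" if "R \<subseteq> ?V" "R \<noteq> {}" "\<And>u v. u \<in> R \<Longrightarrow> adjacent K u v \<Longrightarrow> v \<in> R" for R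
      using neighbour_closed_all[OF K(1) that] .
    show "adjacent K v u" if "adjacent K u v" for u v using that by (subst adjacent_sym)
    show "\<not> adjacent K u u" for u by (simp add: adjacent_def)
    show "v \<in> ?V" if "adjacent K u v" for u v using adjacent_extreme(2)[OF that] by simp
  qed (use \<open>?V \<noteq> {}\<close> finite_extreme_points_polytope[OF K(1)] in simp_all)
  also have "\<lparr>verts = ?V, edges = {{u, v} | u v. adjacent K u v}\<rparr> = polytope_graph K"
    using edges_eq_adjacent[OF K(1)] vertices_of_eq_extreme[OF K(1)]
    by (simp add: polytope_graph_def)
  finally show ?thesis .
qed

lemma polygon_graph_facial_cycle:
  fixes P :: "'a::euclidean_space set"
  assumes P: "polytope P" and K: "K face_of P" "aff_dim K = 2"
  shows "facial_cycle P (polytope_graph K)"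
proof -
  have pK: "polytope K" using face_of_polytope_polytope[OF P K(1)] .
  have "verts (polytope_graph K) \<subseteq> verts (polytope_graph P)"
    using extreme_point_of_face[OF K(1)]
    by (auto simp: polytope_graph_def vertices_of_eq_extreme P pK)
  moreover have "edges (polytope_graph K) \<subseteq> edges (polytope_graph P)"
    using adjacent_face[OF K(1)] by (auto simp: edges_eq_adjacent P pK)
  ultimately have "cycle_in (polytope_graph K) (polytope_graph P)"
    using polygon_graph_cycle[OF pK K(2)] ugraph_polytope_graph[OF pK]
    by (simp add: cycle_in_def subgraph_def)
  then show ?thesis
    using K P by (auto simp: facial_cycle_def face_of_dim_def exposed_face_of_polytope)
qed

section \<open>Elimination over the two-element field\<close>

lemma even_card_sym_diff:
  assumes "finite A" "finite B"
  shows "even (card (sym_diff A B)) \<longleftrightarrow> (even (card A) \<longleftrightarrow> even (card B))"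
proof -
  have "card (sym_diff A B) = card (A - B) + card (B - A)"
    using assms by (intro card_Un_disjoint) auto
  moreover have "card A = card (A - B) + card (A \<inter> B)"
    using assms card_Diff_subset_Int[of A B] card_mono[of A "A \<inter> B"] by simp
  moreover have "card B = card (B - A) + card (A \<inter> B)"
    using assms card_Diff_subset_Int[of B A] card_mono[of B "B \<inter> A"] by (simp add: Int_commute)
  ultimately show ?thesis by auto
qed

lemma finite_rank_function:
  fixes r :: "'e \<Rightarrow> 'e \<Rightarrow> bool"
  assumes "finite A" "transp r" "irreflp r"
  shows "\<exists>rank :: 'e \<Rightarrow> nat. \<forall>x\<in>A. \<forall>y\<in>A. r x y \<longrightarrow> rank x < rank y"
proof -
  have "card {z \<in> A. r z x} < card {z \<in> A. r z y}" if "x \<in> A" "r x y" for x y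
  proof (rule psubset_card_mono)
    show "{z \<in> A. r z x} \<subset> {z \<in> A. r z y}"
      using that transpD[OF assms(2)] irreflpD[OF assms(3)] by blast
  qed (use assms(1) in simp)
  then show ?thesis
    by (intro exI[of _ "\<lambda>x. card {z \<in> A. r z x}"]) simp
qed

text \<open>
  Gaussian elimination over the two-element field. Here \<open>Q\<close> describes a space of sets, and
  \<open>f C\<close> for \<open>B C\<close> are the available generators. If the highest-ranked element of every
  nonempty member of the space is also the highest-ranked element of some generator, then adding that
  generator removes it and brings in only elements of lower rank.
\<close>

lemma eliminate_leading_edges:
  fixes rank :: "'e \<Rightarrow> nat"
  assumes inj: "inj_on rank A"
    and sub: "\<And>X. Q X \<Longrightarrow> X \<subseteq> A"
    and diff: "\<And>X C. Q X \<Longrightarrow> B C \<Longrightarrow> Q (sym_diff (f C) X)"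
    and pivot: "\<And>X e. Q X \<Longrightarrow> e \<in> X \<Longrightarrow> (\<And>x. x \<in> X \<Longrightarrow> rank x \<le> rank e) \<Longrightarrow>
      \<exists>C. B C \<and> e \<in> f C \<and> (\<forall>x\<in>f C. rank x \<le> rank e)"
    and X: "Q X" "\<forall>e\<in>X. rank e < n"
  shows "\<exists>Cs. (\<forall>C\<in>set Cs. B C) \<and> X = foldr (\<lambda>C Y. sym_diff (f C) Y) Cs {}"
  using X
proof (induction n arbitrary: X)
  case 0
  then show ?case by (intro exI[of _ "[]"]) auto
next
  case (Suc n)
  show ?case
  proof (cases "\<exists>e\<in>X. rank e = n")
    case False
    then have "\<forall>e\<in>X. rank e < n" using Suc.prems(2) less_Suc_eq by blast
    then show ?thesis using Suc.IH Suc.prems(1) by blast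
  next
    case True
    then obtain e where e: "e \<in> X" "rank e = n" by blast
    then obtain C where C: "B C" "e \<in> f C" "\<forall>x\<in>f C. rank x \<le> n"
      using pivot[OF Suc.prems(1) e(1)] Suc.prems(2) less_Suc_eq_le by metis
    define Y where "Y = sym_diff (f C) X"
    have QY: "Q Y" unfolding Y_def using diff[OF Suc.prems(1) C(1)] .
    have "rank x < n" if x: "x \<in> Y" for x
    proof -
      have "rank x \<le> n" using x C(3) Suc.prems(2) by (auto simp: Y_def less_Suc_eq_le)
      moreover have "rank x \<noteq> n"
      proof
        assume "rank x = n"
        then have "x = e"
          using inj_onD[OF inj] e sub[OF QY] sub[OF Suc.prems(1)] x by blast
        then show False using x e C by (auto simp: Y_def)
      qed
      ultimately show ?thesis by simp
    qed
    then obtain Cs where Cs: "\<forall>C\<in>set Cs. B C"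
      "Y = foldr (\<lambda>C Y. sym_diff (f C) Y) Cs {}"
      using Suc.IH[OF QY] by blast
    have "X = sym_diff (f C) Y" unfolding Y_def by blast
    then have "X = foldr (\<lambda>C Y. sym_diff (f C) Y) (C # Cs) {}" using Cs(2) by simp
    moreover have "\<forall>D\<in>set (C # Cs). B D" using C(1) Cs(1) by simp
    ultimately show ?thesis by blast
  qed
qed

section \<open>The order of the edges in a generic sweep\<close>

text \<open>
  The rate at which \<open>c\<close> changes in the direction from \<open>v\<close> to \<open>x\<close>, when directions are normalised
  by \<open>a\<close>. Division by zero gives \<open>v\<close> itself the slope \<open>0\<close>; where \<open>a\<close> is larger than at
  \<open>v\<close>, a negative slope means a height below that of \<open>v\<close>.
\<close>

definition slope :: "'a::real_inner \<Rightarrow> 'a \<Rightarrow> 'a \<Rightarrow> 'a \<Rightarrow> real" where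
  "slope c a v x = (c \<bullet> (x - v)) / (a \<bullet> (x - v))"

text \<open>
  The normalisation by \<open>a\<close> keeps different directions apart, because two extreme points on one ray
  from \<open>v\<close> would have one of them between \<open>v\<close> and the other.
\<close>

lemma extreme_on_ray_unique:
  assumes P: "convex P" and ext: "u extreme_point_of P" "w extreme_point_of P" "v \<in> P"
    and pos: "a \<bullet> (u - v) > 0" "a \<bullet> (w - v) > 0"
    and eq: "(1 / (a \<bullet> (u - v))) *\<^sub>R (u - v) = (1 / (a \<bullet> (w - v))) *\<^sub>R (w - v)"
    and le: "a \<bullet> (u - v) \<le> a \<bullet> (w - v)"
  shows "u = w"
proof (rule ccontr)
  assume "u \<noteq> w"
  define t where "t = a \<bullet> (u - v) / (a \<bullet> (w - v))"
  have "u - v = (a \<bullet> (u - v)) *\<^sub>R ((1 / (a \<bullet> (u - v))) *\<^sub>R (u - v))" using pos by simp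
  also have "\<dots> = t *\<^sub>R (w - v)" unfolding eq by (simp add: t_def)
  finally have u: "u - v = t *\<^sub>R (w - v)" .
  then have u': "u = (1 - t) *\<^sub>R v + t *\<^sub>R w" by (simp add: algebra_simps)
  have "t > 0" "t \<le> 1" using pos le by (simp_all add: t_def)
  moreover have "t \<noteq> 1" using u \<open>u \<noteq> w\<close> by auto
  moreover have "v \<noteq> w" using pos by auto
  ultimately have "u \<in> open_segment v w" unfolding in_segment using u' by force
  moreover have "w \<in> P" using ext by (simp add: extreme_point_of_def)
  ultimately show False using ext by (auto simp: extreme_point_of_def)
qed

text \<open>
  The functional \<open>c\<close> gives the height of a vertex, and \<open>a v\<close> exposes the vertex \<open>v\<close>. Slopes at
  \<open>v\<close> are required to be different at all vertices, \<open>v\<close> included; as \<open>v\<close> has slope \<open>0\<close>, this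
  makes heights different too.
\<close>

locale sweep =
  fixes P :: "'a::euclidean_space set" and c :: 'a and a :: "'a \<Rightarrow> 'a"
  assumes poly: "polytope P"
    and exposes: "\<And>v x. v extreme_point_of P \<Longrightarrow> x \<in> P \<Longrightarrow> x \<noteq> v \<Longrightarrow> a v \<bullet> (x - v) > 0"
    and slope_inj: "\<And>v. v extreme_point_of P \<Longrightarrow> inj_on (slope c (a v) v) {x. x extreme_point_of P}"

lemma sweep_exists:
  fixes P :: "'a::euclidean_space set"
  assumes P: "polytope P"
  shows "\<exists>c a. sweep P c a"
proof -
  let ?V = "{x. x extreme_point_of P}"
  have "\<exists>a. \<forall>x\<in>P. x \<noteq> v \<longrightarrow> a \<bullet> (x - v) > 0" if v: "v extreme_point_of P" for v
  proof -
    have "{v} face_of P" using v by (simp add: face_of_singleton)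
    then obtain a b where ab: "\<And>y. y \<in> P \<Longrightarrow> b \<le> a \<bullet> y" "\<And>y. y \<in> P \<Longrightarrow> y \<in> {v} \<longleftrightarrow> a \<bullet> y = b"
      using face_polytope_exposed[OF P] by metis
    have "v \<in> P" using v by (simp add: extreme_point_of_def)
    then have "a \<bullet> v = b" using ab(2) by blast
    have "a \<bullet> (x - v) > 0" if "x \<in> P" "x \<noteq> v" for x
      using ab[OF that(1)] that(2) \<open>a \<bullet> v = b\<close> by (simp add: inner_diff_right)
    then show ?thesis by blast
  qed
  then obtain a where a: "\<And>v x. v extreme_point_of P \<Longrightarrow> x \<in> P \<Longrightarrow> x \<noteq> v \<Longrightarrow> a v \<bullet> (x - v) > 0"
    by metis
  have VP: "x \<in> P" if "x extreme_point_of P" for x using that by (simp add: extreme_point_of_def)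
  define y where "y v x = (1 / (a v \<bullet> (x - v))) *\<^sub>R (x - v)" for v x
  have y_inj: "y v u \<noteq> y v w"
    if ext: "v extreme_point_of P" "u extreme_point_of P" "w extreme_point_of P" and "u \<noteq> w" for v u w
  proof
    assume eq: "y v u = y v w"
    have y0: "y v x = 0 \<longleftrightarrow> x = v" if "x extreme_point_of P" for x
      using a[OF ext(1) VP[OF that]] by (cases "x = v") (auto simp: y_def)
    have "u \<noteq> v" "w \<noteq> v" using y0[of u] y0[of w] y0[of v] ext eq \<open>u \<noteq> w\<close> by metis+
    then have pos: "a v \<bullet> (u - v) > 0" "a v \<bullet> (w - v) > 0" using a ext VP by blast+
    note ray = extreme_on_ray_unique[OF polytope_imp_convex[OF P] _ _ VP[OF ext(1)]]
    have "u = w"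
    proof (cases "a v \<bullet> (u - v) \<le> a v \<bullet> (w - v)")
      case True
      show ?thesis using ray[OF ext(2,3) pos eq[unfolded y_def] True] .
    next
      case False
      then show ?thesis
        using ray[OF ext(3,2) pos(2,1) eq[symmetric, unfolded y_def]] by simp
    qed
    then show False using \<open>u \<noteq> w\<close> by simp
  qed
  \<comment> \<open>The slopes at \<open>v\<close> are the values of \<open>c\<close> on the vectors \<open>y v x\<close>, so that \<open>c\<close> only
    has to be nonzero on finitely many differences of such vectors.\<close>
  define I where "I = {(v, u, w). v \<in> ?V \<and> u \<in> ?V \<and> w \<in> ?V \<and> u \<noteq> w}"
  have "finite I"
    using finite_extreme_points_polytope[OF P]
    by (intro finite_subset[of I "?V \<times> ?V \<times> ?V"]) (auto simp: I_def)
  then have "\<exists>c. \<forall>i\<in>I. c \<bullet> (case i of (v, u, w) \<Rightarrow> y v u - y v w) \<noteq> 0"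
    using y_inj by (intro generic_functional) (auto simp: I_def)
  then obtain c where c_I: "\<forall>i\<in>I. c \<bullet> (case i of (v, u, w) \<Rightarrow> y v u - y v w) \<noteq> 0" by blast
  have c: "c \<bullet> (y v u - y v w) \<noteq> 0" if "(v, u, w) \<in> I" for v u w
    using bspec[OF c_I that] by simp
  have "slope c (a v) v x = c \<bullet> y v x" for v x by (simp add: slope_def y_def)
  then have "inj_on (slope c (a v) v) ?V" if "v extreme_point_of P" for v
    using c[of v] that by (intro inj_onI) (force simp: I_def inner_diff_right)
  then have "sweep P c a" using P a by unfold_locales auto
  then show ?thesis by blast
qed

context sweep
begin

lemma height_inj:
  assumes "u extreme_point_of P" "v extreme_point_of P" "u \<noteq> v"
  shows "c \<bullet> u \<noteq> c \<bullet> v"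
proof
  assume "c \<bullet> u = c \<bullet> v"
  then have "slope c (a v) v u = slope c (a v) v v" by (simp add: slope_def inner_diff_right)
  then show False using inj_onD[OF slope_inj[OF assms(2)]] assms by blast
qed

text \<open>
  Edges are compared by the height of their upper end, and edges with the same upper end by their
  slope there.
\<close>

definition precedes :: "'a set \<Rightarrow> 'a set \<Rightarrow> bool" where
  "precedes e e' \<longleftrightarrow> (\<exists>v u v' u'. e = {v, u} \<and> e' = {v', u'} \<and> c \<bullet> u < c \<bullet> v \<and> c \<bullet> u' < c \<bullet> v' \<and>
     (c \<bullet> v < c \<bullet> v' \<or> v = v' \<and> slope c (a v) v u < slope c (a v) v u'))"

lemma precedes_iff:
  assumes "c \<bullet> u < c \<bullet> v" "c \<bullet> u' < c \<bullet> v'"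
  shows "precedes {v, u} {v', u'} \<longleftrightarrow>
    c \<bullet> v < c \<bullet> v' \<or> v = v' \<and> slope c (a v) v u < slope c (a v) v u'"
proof
  assume "precedes {v, u} {v', u'}"
  then obtain x y x' y' where xy: "{v, u} = {x, y}" "{v', u'} = {x', y'}" "c \<bullet> y < c \<bullet> x"
      "c \<bullet> y' < c \<bullet> x'"
    and lt: "c \<bullet> x < c \<bullet> x' \<or> x = x' \<and> slope c (a x) x y < slope c (a x) x y'"
    unfolding precedes_def by blast
  have "v = x" "u = y" using xy(1,3) assms(1) unfolding doubleton_eq_iff by auto
  moreover have "v' = x'" "u' = y'" using xy(2,4) assms(2) unfolding doubleton_eq_iff by auto
  ultimately show "c \<bullet> v < c \<bullet> v' \<or> v = v' \<and> slope c (a v) v u < slope c (a v) v u'"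
    using lt by simp
next
  assume "c \<bullet> v < c \<bullet> v' \<or> v = v' \<and> slope c (a v) v u < slope c (a v) v u'"
  then show "precedes {v, u} {v', u'}" unfolding precedes_def using assms by blast
qed

lemma precedesE:
  assumes "precedes e e'"
  obtains v u v' u' where "e = {v, u}" "e' = {v', u'}" "c \<bullet> u < c \<bullet> v" "c \<bullet> u' < c \<bullet> v'"
  using assms unfolding precedes_def by blast

lemma transp_precedes: "transp precedes"
proof (rule transpI)
  fix e1 e2 e3 assume 12: "precedes e1 e2" and 23: "precedes e2 e3"
  obtain v1 u1 v2 u2 where e: "e1 = {v1, u1}" "e2 = {v2, u2}" "c \<bullet> u1 < c \<bullet> v1" "c \<bullet> u2 < c \<bullet> v2"
    using 12 by (rule precedesE)
  obtain v2' u2' v3 u3 where e3: "e3 = {v3, u3}" "c \<bullet> u3 < c \<bullet> v3"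
    using 23 by (rule precedesE)
  show "precedes e1 e3"
    using 12 23 unfolding e e3 precedes_iff[OF e(3,4)] precedes_iff[OF e(4) e3(2)]
      precedes_iff[OF e(3) e3(2)] by auto
qed

lemma irreflp_precedes: "irreflp precedes"
proof (rule irreflpI)
  show "\<not> precedes e e" for e
    unfolding precedes_def by (auto simp: doubleton_eq_iff)
qed

lemma oriented_edge:
  assumes "e \<in> edges (polytope_graph P)"
  obtains v u where "e = {v, u}" "adjacent P v u" "c \<bullet> u < c \<bullet> v"
proof -
  obtain x y where xy: "e = {x, y}" "adjacent P x y"
    using assms by (auto simp: edges_eq_adjacent[OF poly])
  then have "c \<bullet> x \<noteq> c \<bullet> y"
    using height_inj adjacent_extreme[OF xy(2)] by (simp add: adjacent_def)
  then consider "c \<bullet> y < c \<bullet> x" | "c \<bullet> x < c \<bullet> y" by linarith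
  then show thesis
  proof cases
    case 1
    then show thesis using that xy by blast
  next
    case 2
    moreover have "adjacent P y x" using xy(2) adjacent_sym by blast
    ultimately show thesis using that[of y x] xy(1) by blast
  qed
qed

lemma precedes_total:
  assumes "e \<in> edges (polytope_graph P)" "e' \<in> edges (polytope_graph P)" "e \<noteq> e'"
  shows "precedes e e' \<or> precedes e' e"
proof -
  obtain v u where e: "e = {v, u}" "adjacent P v u" "c \<bullet> u < c \<bullet> v"
    using assms(1) by (rule oriented_edge)
  obtain v' u' where e': "e' = {v', u'}" "adjacent P v' u'" "c \<bullet> u' < c \<bullet> v'"
    using assms(2) by (rule oriented_edge)
  show ?thesis
  proof (cases "v = v'")
    case False
    then have "c \<bullet> v \<noteq> c \<bullet> v'"
      using height_inj adjacent_extreme(1) e(2) e'(2) by blast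
    then show ?thesis
      unfolding e(1) e'(1) precedes_iff[OF e(3) e'(3)] precedes_iff[OF e'(3) e(3)] by linarith
  next
    case True
    then have "u \<noteq> u'" using assms(3) e e' by blast
    then have "slope c (a v) v u \<noteq> slope c (a v) v u'"
      using inj_onD[OF slope_inj] adjacent_extreme e(2) e'(2) by blast
    then show ?thesis
      unfolding e(1) e'(1) precedes_iff[OF e(3) e'(3)] precedes_iff[OF e'(3) e(3)]
      using True by auto
  qed
qed

text \<open>
  At the upper end \<open>v\<close> of the last edge \<open>e\<close> of an even set there is a second edge of the set, and
  that one is downward and steeper because it precedes \<open>e\<close>. Hence slopes smaller than that of
  \<open>e\<close> occur at \<open>v\<close>, which says that a functional vanishing along \<open>e\<close> is somewhere negative. By local
  improvement it is negative on some 2-face through \<open>e\<close>, so that the other edge of this 2-face at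
  \<open>v\<close> is downward and steeper than \<open>e\<close>. As both its edges at \<open>v\<close> go down, \<open>v\<close> is the
  highest point of the 2-face, and all its remaining edges have a lower upper end.
\<close>

lemma last_edge_has_facial_cycle:
  assumes X: "X \<subseteq> edges (polytope_graph P)" "finite X"
    and even: "\<And>v. v extreme_point_of P \<Longrightarrow> even (card {e \<in> X. v \<in> e})"
    and e: "e \<in> X" "\<And>x. x \<in> X \<Longrightarrow> \<not> precedes e x"
  obtains K where "K face_of P" "aff_dim K = 2" "e \<in> edges (polytope_graph K)"
    "\<And>x. x \<in> edges (polytope_graph K) \<Longrightarrow> x = e \<or> precedes x e"
proof -
  have eP: "e \<in> edges (polytope_graph P)" using e(1) X(1) by blast
  obtain v u where vu: "e = {v, u}" "adjacent P v u" "c \<bullet> u < c \<bullet> v"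
    by (rule oriented_edge[OF eP])
  note v_ext = adjacent_extreme(1)[OF vu(2)]
  have "{x \<in> X. v \<in> x} \<noteq> {e}"
  proof
    assume "{x \<in> X. v \<in> x} = {e}"
    then have "card {x \<in> X. v \<in> x} = 1" by simp
    then show False using even[OF v_ext] by simp
  qed
  moreover have "e \<in> {x \<in> X. v \<in> x}" using e(1) vu(1) by simp
  ultimately obtain e' where e': "e' \<in> X" "v \<in> e'" "e' \<noteq> e" by blast
  have "e' \<in> edges (polytope_graph P)" using X(1) e'(1) by blast
  then obtain w where w: "e' = {v, w}" "adjacent P v w"
    using e'(2) by (rule edge_at_vertex[OF poly])
  have "u \<noteq> w" using e' w vu by auto
  note np = e(2)[OF e'(1), unfolded vu(1) w(1)]
  have w_low: "c \<bullet> w < c \<bullet> v"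
  proof (rule ccontr)
    assume "\<not> ?thesis"
    then have "c \<bullet> v < c \<bullet> w"
      using height_inj[OF _ v_ext, of w] adjacent_extreme(2)[OF w(2)] w(2)
      by (force simp: adjacent_def)
    then have "precedes {v, u} {w, v}" using precedes_iff[OF vu(3)] by blast
    then show False using np by (simp add: insert_commute)
  qed
  define s where "s = slope c (a v) v u"
  have "slope c (a v) v w \<noteq> s"
    using inj_onD[OF slope_inj[OF v_ext]] adjacent_extreme(2) vu(2) w(2) \<open>u \<noteq> w\<close>
    unfolding s_def by blast
  then have w_slope: "slope c (a v) v w < s"
    using np precedes_iff[OF vu(3) w_low] by (auto simp: s_def)
  have pos: "a v \<bullet> (x - v) > 0" if "x \<in> P" "x \<noteq> v" for x using exposes[OF v_ext that] .
  have uP: "u \<in> P" "u \<noteq> v" and wP: "w \<in> P" "w \<noteq> v"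
    using adjacent_extreme(2) vu(2) w(2) by (auto simp: adjacent_def extreme_point_of_def)
  have "s < 0"
    using vu(3) pos[OF uP] by (simp add: s_def slope_def inner_diff_right divide_neg_pos)
  \<comment> \<open>A direction at \<open>v\<close> has slope less than \<open>s\<close> exactly if \<open>g\<close> decreases along it.\<close>
  define g where "g = c - s *\<^sub>R a v"
  have g: "g \<bullet> x - g \<bullet> v = c \<bullet> (x - v) - s * (a v \<bullet> (x - v))" for x
    by (simp add: g_def inner_diff_left inner_diff_right algebra_simps)
  have g_slope: "g \<bullet> x < g \<bullet> v \<longleftrightarrow> slope c (a v) v x < s" if "x \<in> P" "x \<noteq> v" for x
  proof -
    have "g \<bullet> x < g \<bullet> v \<longleftrightarrow> c \<bullet> (x - v) < s * (a v \<bullet> (x - v))"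
      using g[of x] by linarith
    also have "\<dots> \<longleftrightarrow> slope c (a v) v x < s"
      unfolding slope_def using pos_divide_less_eq[OF pos[OF that]] by blast
    finally show ?thesis .
  qed
  have "a v \<bullet> (u - v) \<noteq> 0" using pos[OF uP] by linarith
  then have "c \<bullet> (u - v) = s * (a v \<bullet> (u - v))"
    unfolding s_def slope_def by (simp only: nonzero_divide_eq_eq times_divide_eq_left) simp
  then have gu: "g \<bullet> u = g \<bullet> v" using g[of u] by linarith
  have on_edge: "g \<bullet> x = g \<bullet> v" if x: "x \<in> closed_segment v u" for x
  proof -
    obtain t where "x = (1 - t) *\<^sub>R v + t *\<^sub>R u" using x unfolding in_segment by blast
    then have "g \<bullet> x = (1 - t) * (g \<bullet> v) + t * (g \<bullet> v)" by (simp add: inner_add_right gu)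
    then show ?thesis by (simp add: left_diff_distrib)
  qed
  have edge: "closed_segment v u face_of P" using vu(2) by (simp add: adjacent_def)
  have "closed_segment v u \<noteq> {}" by simp
  moreover have "g \<bullet> w < g \<bullet> v" using g_slope[OF wP] w_slope by blast
  ultimately obtain K where K: "K face_of P" "closed_segment v u \<subseteq> K"
      "aff_dim K = aff_dim (closed_segment v u) + 1"
      "\<And>x. x \<in> K - closed_segment v u \<Longrightarrow> g \<bullet> x < g \<bullet> v"
    using descending_face[OF poly edge _ on_edge wP(1)] by metis
  have dim: "aff_dim K = 2"
    using K(3) uP(2) by (simp add: segment_convex_hull aff_dim_convex_hull aff_dim_2)
  have pK: "polytope K" using face_of_polytope_polytope[OF poly K(1)] .
  have KP: "K \<subseteq> P" using K(1) face_of_imp_subset by blast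
  have Kvu: "adjacent K v u" using adjacent_face[OF K(1)] vu(2) K(2) by blast
  obtain p q where pq: "p \<noteq> q" "{x. adjacent K v x} = {p, q}"
    by (rule polygon_two_neighbours[OF pK dim adjacent_extreme(1)[OF Kvu]])
  then have "u = p \<or> u = q" using Kvu by blast
  then have "\<exists>z. z \<noteq> u \<and> {x. adjacent K v x} = {u, z}"
    using pq(1) unfolding pq(2) by (metis insert_commute)
  then obtain z where z: "z \<noteq> u" "{x. adjacent K v x} = {u, z}" by blast
  have Kvz: "adjacent K v z" and nbr: "\<And>y. adjacent K v y \<Longrightarrow> y = u \<or> y = z"
    using z(2) by (simp_all add: set_eq_iff)
  then have zP: "z \<in> P" "z \<noteq> v" and "z \<in> K"
    using adjacent_extreme(2)[OF Kvz] KP by (auto simp: adjacent_def extreme_point_of_def)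
  have gz: "g \<bullet> z < g \<bullet> v"
    using K(4) neighbour_not_on_edge[OF Kvz Kvu z(1)] \<open>z \<in> K\<close> by blast
  then have z_slope: "slope c (a v) v z < s" using g_slope[OF zP] by blast
  then have "(c \<bullet> (z - v)) / (a v \<bullet> (z - v)) < 0"
    using \<open>s < 0\<close> unfolding slope_def by linarith
  then have "c \<bullet> (z - v) < 0" using pos[OF zP] by (meson divide_less_0_iff order_less_asym)
  then have z_low: "c \<bullet> z < c \<bullet> v" by (simp add: inner_diff_right)
  have top: "c \<bullet> x \<le> c \<bullet> v" if x: "x \<in> K" for x
  proof (rule ccontr)
    assume "\<not> ?thesis"
    then have "(- c) \<bullet> x < (- c) \<bullet> v" by simp
    then obtain y where y: "adjacent K v y" "(- c) \<bullet> y < (- c) \<bullet> v"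
      by (rule descending_edge[OF pK adjacent_extreme(1)[OF Kvu] x])
    then have "y = u \<or> y = z" using nbr by simp
    then show False using y(2) vu(3) z_low by auto
  qed
  have "x = e \<or> precedes x e" if x: "x \<in> edges (polytope_graph K)" for x
  proof (cases "v \<in> x")
    case True
    obtain y where "x = {v, y}" "adjacent K v y"
      using x True by (rule edge_at_vertex[OF pK])
    moreover have "precedes {v, z} {v, u}"
      using precedes_iff[OF z_low vu(3)] z_slope unfolding s_def by blast
    ultimately show ?thesis using nbr[of y] unfolding vu(1) by metis
  next
    case False
    have "x \<in> edges (polytope_graph P)"
      using x adjacent_face[OF K(1)] by (auto simp: edges_eq_adjacent poly pK)
    then obtain v' u' where x': "x = {v', u'}" "adjacent P v' u'" "c \<bullet> u' < c \<bullet> v'"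
      by (rule oriented_edge)
    have "{v', u'} \<in> edges (polytope_graph K)" using x x' by simp
    then have "v' extreme_point_of K"
      using adjacent_extreme(1) by (simp add: doubleton_edge_iff[OF pK])
    then have "v' \<in> K" by (simp add: extreme_point_of_def)
    then have "c \<bullet> v' < c \<bullet> v"
      using top[of v'] height_inj[OF adjacent_extreme(1)[OF x'(2)] v_ext] False x'(1) by force
    then show ?thesis using precedes_iff[OF x'(3) vu(3)] x'(1) vu(1) by blast
  qed
  moreover have "e \<in> edges (polytope_graph K)"
    using Kvu by (simp add: vu(1) doubleton_edge_iff[OF pK])
  ultimately show thesis using that K(1) dim by blast
qed

end

section \<open>Generation by facial cycles\<close>

lemma graph_sym_diffs_as_spanning:
  "graph_sym_diffs G (map (as_spanning G) Cs) =
    \<lparr>verts = verts G, edges = foldr (\<lambda>C Y. sym_diff (edges C) Y) Cs {}\<rparr>"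
  by (induction Cs) (simp_all add: graph_sym_diffs_def graph_sym_diff_def as_spanning_def)

lemma even_subgraph_sum_of_facial_cycles:
  fixes P :: "'a::euclidean_space set"
  assumes P: "polytope P" and H: "even_subgraph H (polytope_graph P)"
  shows "\<exists>Cs. (\<forall>C\<in>set Cs. facial_cycle P C) \<and>
    H = graph_sym_diffs (polytope_graph P) (map (as_spanning (polytope_graph P)) Cs)"
proof -
  let ?G = "polytope_graph P" and ?V = "{v. v extreme_point_of P}"
  let ?E = "edges ?G"
  define Q where "Q X \<longleftrightarrow> X \<subseteq> ?E \<and> (\<forall>v\<in>?V. even (card {e \<in> X. v \<in> e}))" for X
  have verts: "verts ?G = ?V" by (simp add: polytope_graph_def vertices_of_eq_extreme[OF P])
  have Q_even: "Q (edges H')" if "even_subgraph H' ?G" for H'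
    using that verts
    by (simp add: Q_def even_subgraph_def spanning_subgraph_def subgraph_def degree_def)
  have finE: "finite ?E"
  proof (rule finite_subset)
    show "?E \<subseteq> Pow ?V" using ugraph_polytope_graph[OF P] verts by (auto simp: ugraph_def)
  qed (use finite_extreme_points_polytope[OF P] in simp)
  obtain c a where "sweep P c a" using sweep_exists[OF P] by blast
  then interpret sweep P c a .
  obtain rank :: "'a set \<Rightarrow> nat" where rank: "\<And>x y. x \<in> ?E \<Longrightarrow> y \<in> ?E \<Longrightarrow> precedes x y \<Longrightarrow> rank x < rank y"
    using finite_rank_function[OF finE transp_precedes irreflp_precedes] by blast
  have inj: "inj_on rank ?E"
    using rank precedes_total by (intro inj_onI) (metis less_irrefl)
  have diff: "Q (sym_diff (edges C) X)" if X: "Q X" and C: "facial_cycle P C" for X C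
  proof -
    have "even_subgraph (as_spanning ?G C) ?G"
      using C cycle_imp_even_subgraph ugraph_polytope_graph[OF P] by (auto simp: facial_cycle_def)
    then have QC: "Q (edges C)" using Q_even by (fastforce simp: as_spanning_def)
    have "even (card {e \<in> sym_diff (edges C) X. v \<in> e})" if "v \<in> ?V" for v
    proof -
      let ?A = "{e \<in> edges C. v \<in> e}" and ?B = "{e \<in> X. v \<in> e}"
      have "{e \<in> sym_diff (edges C) X. v \<in> e} = sym_diff ?A ?B" by blast
      moreover have "finite ?A" "finite ?B"
        using X QC finE by (auto simp: Q_def intro: finite_subset)
      ultimately show ?thesis
        using even_card_sym_diff[of ?A ?B] X QC that by (simp add: Q_def)
    qed
    then show ?thesis using X QC by (auto simp: Q_def)
  qed
  have pivot: "\<exists>C. facial_cycle P C \<and> e \<in> edges C \<and> (\<forall>x\<in>edges C. rank x \<le> rank e)"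
    if X: "Q X" and e: "e \<in> X" "\<And>x. x \<in> X \<Longrightarrow> rank x \<le> rank e" for X e
  proof -
    have XE: "X \<subseteq> ?E" and even: "\<And>v. v extreme_point_of P \<Longrightarrow> even (card {e \<in> X. v \<in> e})"
      using X by (auto simp: Q_def)
    have "\<not> precedes e x" if "x \<in> X" for x
      using rank[of e x] e that XE by (meson linorder_not_le subsetD)
    then obtain K where K: "K face_of P" "aff_dim K = 2" "e \<in> edges (polytope_graph K)"
      "\<And>x. x \<in> edges (polytope_graph K) \<Longrightarrow> x = e \<or> precedes x e"
      using last_edge_has_facial_cycle[OF XE finite_subset[OF XE finE] even e(1)] by metis
    have C: "facial_cycle P (polytope_graph K)" using polygon_graph_facial_cycle[OF P K(1,2)] .
    then have "edges (polytope_graph K) \<subseteq> ?E"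
      by (simp add: facial_cycle_def cycle_in_def subgraph_def)
    then have "\<forall>x\<in>edges (polytope_graph K). rank x \<le> rank e"
      using K(3,4) rank by (metis less_imp_le order_refl subsetD)
    then show ?thesis using C K(3) by blast
  qed
  have QH: "Q (edges H)" using Q_even[OF H] .
  then have "finite (edges H)" using finE finite_subset by (auto simp: Q_def)
  then have bound: "\<forall>e\<in>edges H. rank e < Suc (Max (rank ` edges H))" by (simp add: less_Suc_eq_le)
  have "\<exists>Cs. (\<forall>C\<in>set Cs. facial_cycle P C) \<and>
      edges H = foldr (\<lambda>C Y. sym_diff (edges C) Y) Cs {}"
  proof (rule eliminate_leading_edges[where Q = Q, OF inj _ _ _ QH bound])
    show "X \<subseteq> ?E" if "Q X" for X using that by (simp add: Q_def)
  qed (fact diff pivot)+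
  then obtain Cs where Cs: "\<forall>C\<in>set Cs. facial_cycle P C"
    "edges H = foldr (\<lambda>C Y. sym_diff (edges C) Y) Cs {}"
    by blast
  have "H = \<lparr>verts = verts ?G, edges = edges H\<rparr>"
    using H by (simp add: even_subgraph_def spanning_subgraph_def)
  also have "\<dots> = graph_sym_diffs ?G (map (as_spanning ?G) Cs)"
    using Cs(2) by (simp only: graph_sym_diffs_as_spanning)
  finally show ?thesis using Cs(1) by blast
qed

theorem theorem1:
  fixes P :: "'a::euclidean_space set" and d :: nat
  assumes "2 \<le> d" and "polytope P" and "aff_dim P = int d"
  shows "(\<forall>H. even_subgraph H (polytope_graph P) \<longrightarrow>
            (\<exists>Cs. (\<forall>C\<in>set Cs. facial_cycle P C) \<and>
               H = graph_sym_diffs (polytope_graph P) (map (as_spanning (polytope_graph P)) Cs)))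
       \<and> (\<forall>C. cycle_in C (polytope_graph P) \<longrightarrow>
            (\<exists>Cs. (\<forall>D\<in>set Cs. facial_cycle P D) \<and>
               as_spanning (polytope_graph P) C =
                 graph_sym_diffs (polytope_graph P) (map (as_spanning (polytope_graph P)) Cs)))"
proof -
  let ?G = "polytope_graph P"
  let ?sum = "\<lambda>H. \<exists>Cs. (\<forall>C\<in>set Cs. facial_cycle P C) \<and>
    H = graph_sym_diffs ?G (map (as_spanning ?G) Cs)"
  have even: "\<forall>H. even_subgraph H ?G \<longrightarrow> ?sum H"
    using even_subgraph_sum_of_facial_cycles[OF assms(2)] by simp
  have "\<forall>C. cycle_in C ?G \<longrightarrow> even_subgraph (as_spanning ?G C) ?G"
    using cycle_imp_even_subgraph[OF _ ugraph_polytope_graph[OF assms(2)]] by simp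
  with even have "\<forall>C. cycle_in C ?G \<longrightarrow> ?sum (as_spanning ?G C)" by simp
  with even show ?thesis by (rule conjI)
qed

end
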